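(* Let $ABC$ be a triangle with $\angle ABC=120^\circ$ and let $P$ be its incenter. Let the cevians through $P$ be $AD$, $BE$, $CF$ with $D$ on $BC$, $E$ on $CA$, $F$ on $AB$, and let $r_1,\dots,r_6$ be the inradii of triangles $PBD$, $PDC$, $PCE$, $PEA$, $PAF$, $PFB$, respectively. Then $$r_1r_2r_3+r_3r_4r_5+r_3r_4r_6=r_1r_3r_4+r_2r_3r_4+r_4r_5r_6.$$
   Context: For a point $P$ inside $\triangle ABC$, line $AP$ meets side $BC$ at $D$, line $BP$ meets side $CA$ at $E$, and line $CP$ meets side $AB$ at $F$. The three cevians divide $\triangle ABC$ into six smaller triangles, numbered 1 to 6 in the order $PBD$, $PDC$, $PCE$, $PEA$, $PAF$, $PFB$; $r_i$ is the inradius of the $i$-th triangle. *)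

theory Defs
  imports "HOL-Analysis.Analysis"
begin

text \<open>The unoriented angle at the vertex \<open>B\<close>, in radians; used only for \<open>A \<noteq> B\<close> and \<open>C \<noteq> B\<close>.\<close>

definition angle :: "real^2 \<Rightarrow> real^2 \<Rightarrow> real^2 \<Rightarrow> real" where
  "angle A B C = arccos (((A - B) \<bullet> (C - B)) / (norm (A - B) * norm (C - B)))"

text \<open>
  The circle with centre \<open>I\<close> and radius \<open>r\<close> is the inscribed circle of the triangle \<open>ABC\<close>.
  It is tangent to a line iff its centre is at distance \<open>r\<close> from the line; requiring the centre to
  be an interior point of the triangle rules out the three escribed circles.
\<close>

definition is_incircle :: "real^2 \<Rightarrow> real^2 \<Rightarrow> real^2 \<Rightarrow> real^2 \<Rightarrow> real \<Rightarrow> bool" where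
  "is_incircle A B C I r \<longleftrightarrow>
     I \<in> interior (convex hull {A, B, C}) \<and>
     infdist I (affine hull {B, C}) = r \<and>
     infdist I (affine hull {C, A}) = r \<and>
     infdist I (affine hull {A, B}) = r"

definition is_incenter :: "real^2 \<Rightarrow> real^2 \<Rightarrow> real^2 \<Rightarrow> real^2 \<Rightarrow> bool" where
  "is_incenter A B C I \<longleftrightarrow> (\<exists>r. is_incircle A B C I r)"

definition inradius :: "real^2 \<Rightarrow> real^2 \<Rightarrow> real^2 \<Rightarrow> real" where
  "inradius A B C = (THE r. \<exists>I. is_incircle A B C I r)"

end

theory Submission
  imports Defs
begin

text \<open>
  Dividing by \<open>r3 * r4\<close>, the identity says that \<open>r1 + r2 - r1 * r2 / r4\<close> equals its mirror image
  \<open>r6 + r5 - r6 * r5 / r3\<close> under exchanging \<open>A\<close> and \<open>C\<close>. Both sides equal \<open>(1 - 1 / sqrt 3) * r\<close>,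
  where \<open>r\<close> is the inradius of \<open>ABC\<close>, so one half of the figure suffices. There, each small
  inradius is area over semiperimeter, a rational function of the sides and of \<open>PA\<close>, \<open>PB\<close>, \<open>PC\<close>;
  all these lengths are, up to a common factor, polynomials in \<open>tan (A / 4)\<close> over the rationals
  with \<open>sqrt 3\<close> adjoined.
\<close>

subsection \<open>Inradius and incenter in barycentric coordinates\<close>

definition cross2 :: "real^2 \<Rightarrow> real^2 \<Rightarrow> real" where
  "cross2 u v = u $ 1 * v $ 2 - u $ 2 * v $ 1"

text \<open>Lagrange's identity in the plane: the cross product carries the sine and the inner
  product the cosine of the same angle.\<close>

lemma cross2_sq: "(cross2 u v)\<^sup>2 + (u \<bullet> v)\<^sup>2 = (norm u)\<^sup>2 * (norm v)\<^sup>2"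
  unfolding cross2_def power2_norm_eq_inner inner_vec_def sum_2
  by (simp add: power2_eq_square algebra_simps)

lemma abs_cross2_le: "\<bar>cross2 u v\<bar> \<le> norm u * norm v"
proof -
  have "\<bar>cross2 u v\<bar>\<^sup>2 \<le> (norm u * norm v)\<^sup>2"
    using cross2_sq[of u v] by (simp add: power_mult_distrib) (smt (verit) zero_le_power2)
  then show ?thesis by (rule power2_le_imp_le) simp
qed

lemma cross2_linear:
  "cross2 (u + v) w = cross2 u w + cross2 v w" "cross2 w (u + v) = cross2 w u + cross2 w v"
  "cross2 (c *\<^sub>R u) w = c * cross2 u w" "cross2 w (c *\<^sub>R u) = c * cross2 w u"
  "cross2 u u = 0"
  by (simp_all add: cross2_def algebra_simps)

lemma cross2_commute: "cross2 v u = - cross2 u v"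
  by (simp add: cross2_def)

text \<open>Twice the area; the absolute value removes the orientation, so vertices may be permuted
  freely.\<close>

definition area2 :: "real^2 \<Rightarrow> real^2 \<Rightarrow> real^2 \<Rightarrow> real" where
  "area2 A B C = \<bar>cross2 (B - A) (C - A)\<bar>"

lemma area2_rotate: "area2 B C A = area2 A B C"
  unfolding area2_def by (rule arg_cong[of _ _ abs]) (simp add: cross2_def algebra_simps)

lemma area2_swap: "area2 A C B = area2 A B C"
  unfolding area2_def by (simp add: cross2_commute[of "C - A" "B - A"])

text \<open>By Lagrange's identity the cross product vanishes exactly in the equality case of the
  Cauchy-Schwarz inequality, which is linear dependence of the two edge vectors.\<close>

lemma collinear_iff_area2: "collinear {A, B, C} \<longleftrightarrow> area2 A B C = 0"
proof -
  let ?u = "B - A" and ?v = "C - A"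
  have "collinear {A, B, C} \<longleftrightarrow> collinear {0, ?u, ?v}"
    using collinear_3[of B A C] by (simp add: insert_commute)
  also have "\<dots> \<longleftrightarrow> \<bar>?u \<bullet> ?v\<bar> = norm ?u * norm ?v"
    by (rule norm_cauchy_schwarz_equal[symmetric])
  also have "\<dots> \<longleftrightarrow> (?u \<bullet> ?v)\<^sup>2 = (norm ?u * norm ?v)\<^sup>2"
    by (smt (verit) norm_ge_zero mult_nonneg_nonneg power2_eq_iff power2_abs)
  also have "\<dots> \<longleftrightarrow> area2 A B C = 0"
    using cross2_sq[of ?u ?v] by (auto simp: area2_def power_mult_distrib)
  finally show ?thesis .
qed

text \<open>Twice the area is base times height. Moving a point along the line does not change the
  cross product with the direction, which gives the lower bound; the foot of the perpendicular
  attains it.\<close>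

lemma infdist_line:
  assumes "B \<noteq> C"
  shows "infdist I (affine hull {B, C}) = area2 I B C / norm (C - B)"
proof -
  let ?d = "C - B"
  have d: "norm ?d > 0" using assms by simp
  have cr: "area2 I B C = \<bar>cross2 (I - B) ?d\<bar>"
  proof -
    have "cross2 (B - I) (C - I) = - cross2 (I - B) ?d"
      by (simp add: cross2_def algebra_simps)
    then show ?thesis by (simp add: area2_def)
  qed
  have hull: "affine hull {B, C} = {B + t *\<^sub>R ?d | t. True}"
    by (simp only: affine_hull_2_alt) auto
  have low: "area2 I B C / norm ?d \<le> dist I Q" if "Q \<in> affine hull {B, C}" for Q
  proof -
    from that obtain t where Q: "Q = B + t *\<^sub>R ?d" unfolding hull by blast
    have "cross2 (I - B) ?d = cross2 (I - Q) ?d"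
      unfolding Q by (simp add: cross2_def algebra_simps)
    then have "area2 I B C \<le> dist I Q * norm ?d"
      using abs_cross2_le[of "I - Q" ?d] cr by (simp add: dist_norm)
    then show ?thesis using d by (simp add: divide_simps)
  qed
  \<comment> \<open>Parameter of the orthogonal projection of \<open>I\<close> onto the line:
    \<open>I - Q\<close> is then perpendicular to the direction, and the bound on the cross product
    becomes an equality.\<close>
  define t where "t = ((I - B) \<bullet> ?d) / (norm ?d)\<^sup>2"
  define Q where "Q = B + t *\<^sub>R ?d"
  have Q: "Q \<in> affine hull {B, C}" unfolding hull Q_def by blast
  have "I - Q = (I - B) - t *\<^sub>R ?d" by (simp add: Q_def)
  then have "(I - Q) \<bullet> ?d = (I - B) \<bullet> ?d - t * (norm ?d)\<^sup>2"
    by (simp only: inner_diff_left[of "I - B"] inner_scaleR_left power2_norm_eq_inner)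
  then have "(I - Q) \<bullet> ?d = 0" using d by (simp add: t_def)
  then have sq: "(cross2 (I - Q) ?d)\<^sup>2 = (dist I Q * norm ?d)\<^sup>2"
    using cross2_sq[of "I - Q" ?d] by (simp add: power_mult_distrib dist_norm)
  have "\<bar>cross2 (I - Q) ?d\<bar> = dist I Q * norm ?d"
  proof (rule power2_eq_imp_eq)
    show "\<bar>cross2 (I - Q) ?d\<bar>\<^sup>2 = (dist I Q * norm ?d)\<^sup>2"
      unfolding power2_abs by (rule sq)
  qed simp_all
  moreover have "cross2 (I - B) ?d = cross2 (I - Q) ?d"
    unfolding Q_def by (simp add: cross2_def algebra_simps)
  ultimately have eq: "area2 I B C / norm ?d = dist I Q" using d cr by (simp add: divide_simps)
  show ?thesis
  proof (rule antisym)
    show "infdist I (affine hull {B, C}) \<le> area2 I B C / norm ?d"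
      unfolding eq by (rule infdist_le[OF Q])
    show "area2 I B C / norm ?d \<le> infdist I (affine hull {B, C})"
      using Q low by (subst infdist_notempty) (auto intro!: cINF_greatest)
  qed
qed

text \<open>The cross product is affine in the first vertex and vanishes when that vertex is
  \<open>B\<close> or \<open>C\<close>, so only the weight of \<open>A\<close> survives; being
  nonnegative, it can leave the absolute value.\<close>

lemma area2_barycentric:
  assumes "\<alpha> + \<beta> + \<gamma> = 1" "\<alpha> \<ge> 0"
  shows "area2 (\<alpha> *\<^sub>R A + \<beta> *\<^sub>R B + \<gamma> *\<^sub>R C) B C = \<alpha> * area2 A B C"
proof -
  have \<alpha>: "\<alpha> = 1 - \<beta> - \<gamma>" using assms by simp
  have "cross2 (B - (\<alpha> *\<^sub>R A + \<beta> *\<^sub>R B + \<gamma> *\<^sub>R C)) (C - (\<alpha> *\<^sub>R A + \<beta> *\<^sub>R B + \<gamma> *\<^sub>R C))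
     = \<alpha> * cross2 (B - A) (C - A)"
    unfolding \<alpha> by (simp add: cross2_def) algebra
  then show ?thesis using assms(2) by (simp add: area2_def abs_mult)
qed

lemma not_collinear_distinct:
  assumes "\<not> collinear {A, B, C}"
  shows "A \<noteq> B" "B \<noteq> C" "C \<noteq> A"
  using assms by (auto simp: insert_commute)

text \<open>Interior points are those with positive barycentric weights, and each distance to a side
  is weight times \<open>area2 A B C\<close> over that side. Equal distances thus force weights
  proportional to the sides. This gives existence and uniqueness, so the definite description in
  \<open>inradius\<close> is meaningful.\<close>

lemma is_incircle_iff:
  assumes "\<not> collinear {A, B, C}"
  defines "a \<equiv> norm (C - B)" and "b \<equiv> norm (A - C)" and "c \<equiv> norm (B - A)"
  shows "is_incircle A B C I r \<longleftrightarrow>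
    r = area2 A B C / (a + b + c) \<and> I = (1 / (a + b + c)) *\<^sub>R (a *\<^sub>R A + b *\<^sub>R B + c *\<^sub>R C)"
proof -
  let ?N = "area2 A B C"
  note ne = not_collinear_distinct[OF assms(1)]
  have pos: "a > 0" "b > 0" "c > 0" using ne by (simp_all add: a_def b_def c_def)
  have N: "?N > 0" using assms(1) by (simp add: collinear_iff_area2) (simp add: area2_def)
  have dists: "infdist I (affine hull {B, C}) = \<alpha> * ?N / a"
       "infdist I (affine hull {C, A}) = \<beta> * ?N / b"
       "infdist I (affine hull {A, B}) = \<gamma> * ?N / c"
    if I: "I = \<alpha> *\<^sub>R A + \<beta> *\<^sub>R B + \<gamma> *\<^sub>R C" and s: "\<alpha> + \<beta> + \<gamma> = 1"
      and p: "\<alpha> > 0" "\<beta> > 0" "\<gamma> > 0" for \<alpha> \<beta> \<gamma>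
  proof -
    have "area2 I B C = \<alpha> * ?N" unfolding I using s p by (intro area2_barycentric) auto
    then show "infdist I (affine hull {B, C}) = \<alpha> * ?N / a"
      using infdist_line[OF ne(2)] by (simp add: a_def)
    have "I = \<beta> *\<^sub>R B + \<gamma> *\<^sub>R C + \<alpha> *\<^sub>R A" unfolding I by simp
    then have "area2 I C A = \<beta> * area2 B C A"
      using s p area2_barycentric[of \<beta> \<gamma> \<alpha> B C A] by simp
    then show "infdist I (affine hull {C, A}) = \<beta> * ?N / b"
      using infdist_line[OF ne(3)] by (simp add: b_def area2_rotate)
    have "I = \<gamma> *\<^sub>R C + \<alpha> *\<^sub>R A + \<beta> *\<^sub>R B" unfolding I by simp
    then have "area2 I A B = \<gamma> * area2 C A B"
      using s p area2_barycentric[of \<gamma> \<alpha> \<beta> C A B] by simp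
    then show "infdist I (affine hull {A, B}) = \<gamma> * ?N / c"
      using infdist_line[OF ne(1)] by (simp add: c_def area2_rotate)
  qed
  have int: "interior (convex hull {A, B, C}) = {v. \<exists>x y z. 0 < x \<and> 0 < y \<and> 0 < z \<and>
      x + y + z = 1 \<and> x *\<^sub>R A + y *\<^sub>R B + z *\<^sub>R C = v}"
    by (rule interior_convex_hull_3_minimal[OF assms(1)]) simp
  show ?thesis
  proof
    assume inc: "is_incircle A B C I r"
    then obtain \<alpha> \<beta> \<gamma> where abc: "\<alpha> > 0" "\<beta> > 0" "\<gamma> > 0" "\<alpha> + \<beta> + \<gamma> = 1"
      and I: "I = \<alpha> *\<^sub>R A + \<beta> *\<^sub>R B + \<gamma> *\<^sub>R C"
      unfolding is_incircle_def int by blast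
    have "\<alpha> * ?N / a = r" "\<beta> * ?N / b = r" "\<gamma> * ?N / c = r"
      using dists[OF I abc(4,1-3)] inc unfolding is_incircle_def by auto
    then have w: "\<alpha> = r / ?N * a" "\<beta> = r / ?N * b" "\<gamma> = r / ?N * c"
      using N pos by (auto simp: field_simps)
    \<comment> \<open>The weights are the sides times the common factor \<open>r / ?N\<close>; their
      sum being 1 fixes that factor, hence both \<open>r\<close> and \<open>I\<close>.\<close>
    then have "r / ?N * (a + b + c) = 1" using abc(4) by (simp only: distrib_left)
    then have "r * (a + b + c) = ?N" using N by simp
    then have r: "r = ?N / (a + b + c)" using pos by (simp add: eq_divide_eq)
    then have "r / ?N = 1 / (a + b + c)" using N by simp
    then have "I = (1 / (a + b + c)) *\<^sub>R (a *\<^sub>R A + b *\<^sub>R B + c *\<^sub>R C)"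
      unfolding I w by (simp add: scaleR_add_right)
    with r show "r = ?N / (a + b + c) \<and> I = (1 / (a + b + c)) *\<^sub>R (a *\<^sub>R A + b *\<^sub>R B + c *\<^sub>R C)"
      by simp
  next
    assume h: "r = ?N / (a + b + c) \<and> I = (1 / (a + b + c)) *\<^sub>R (a *\<^sub>R A + b *\<^sub>R B + c *\<^sub>R C)"
    define s where "s = a + b + c"
    have s: "s > 0" using pos by (simp add: s_def)
    have I: "I = (a/s) *\<^sub>R A + (b/s) *\<^sub>R B + (c/s) *\<^sub>R C"
      using h by (simp add: s_def scaleR_add_right)
    have q: "a/s + b/s + c/s = 1" "a/s > 0" "b/s > 0" "c/s > 0"
      using pos s by (simp_all add: s_def add_divide_distrib[symmetric])
    have "I \<in> interior (convex hull {A, B, C})" unfolding int using I q by blast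
    then show "is_incircle A B C I r"
      using dists[OF I q] h pos by (simp add: is_incircle_def s_def)
  qed
qed

lemma inradius_eq:
  assumes "\<not> collinear {A, B, C}"
  shows "inradius A B C = area2 A B C / (norm (C - B) + norm (A - C) + norm (B - A))"
  unfolding inradius_def is_incircle_iff[OF assms] by simp

text \<open>The incircle does not depend on the order of the vertices. This lets
  \<open>P D C\<close> and \<open>P E A\<close> be read as \<open>P C D\<close> and
  \<open>P A E\<close>, the shape that the cevian formula below produces.\<close>

lemma inradius_swap: "inradius A C B = inradius A B C"
proof -
  have "is_incircle A C B I r = is_incircle A B C I r" for I r
    unfolding is_incircle_def by (simp only: insert_commute conj_ac)
  then show ?thesis by (simp add: inradius_def)
qed

section \<open>Triangles cut off by a cevian through a point in barycentric coordinates\<close>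

lemma cevian_foot:
  fixes A B C D P :: "real^2"
  assumes nc: "\<not> collinear {A, B, C}"
    and P: "P = \<alpha> *\<^sub>R A + \<beta> *\<^sub>R B + \<gamma> *\<^sub>R C" "\<alpha> + \<beta> + \<gamma> = 1"
    and pos: "\<alpha> > 0" "\<beta> > 0" "\<gamma> > 0"
    and D: "D \<in> closed_segment B C" "D \<in> affine hull {A, P}"
  shows "D = (\<beta> / (\<beta> + \<gamma>)) *\<^sub>R B + (\<gamma> / (\<beta> + \<gamma>)) *\<^sub>R C"
proof -
  from D(1) obtain m where m: "D = (1 - m) *\<^sub>R B + m *\<^sub>R C" by (auto simp: in_segment)
  from D(2) obtain k l where k: "D = l *\<^sub>R A + k *\<^sub>R P" "l + k = 1" by (auto simp: affine_hull_2)
  define n where "n = cross2 (B - A) (C - A)"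
  have n: "n \<noteq> 0" using nc by (simp add: collinear_iff_area2 area2_def n_def)
  have al: "\<alpha> = 1 - \<beta> - \<gamma>" and l: "l = 1 - k" using P(2) k(2) by simp_all
  \<comment> \<open>\<open>D - A\<close> is written twice in the basis \<open>B - A\<close>,
    \<open>C - A\<close>, once from each line through \<open>D\<close>; cross products with the
    basis vectors then compare coordinates.\<close>
  have d1: "D - A = (1 - m) *\<^sub>R (B - A) + m *\<^sub>R (C - A)"
    unfolding m by (simp add: algebra_simps)
  have d2: "D - A = (k * \<beta>) *\<^sub>R (B - A) + (k * \<gamma>) *\<^sub>R (C - A)"
    unfolding k(1) P(1) al l by (simp add: algebra_simps)
  have "cross2 (B - A) (D - A) = m * n"
    unfolding d1 n_def cross2_linear by simp
  moreover have "cross2 (B - A) (D - A) = k * \<gamma> * n"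
    unfolding d2 n_def cross2_linear by simp
  ultimately have mk: "m = k * \<gamma>" using n by simp
  have "cross2 (D - A) (C - A) = (1 - m) * n"
    unfolding d1 n_def cross2_linear by simp
  moreover have "cross2 (D - A) (C - A) = k * \<beta> * n"
    unfolding d2 n_def cross2_linear by simp
  ultimately have mk': "1 - m = k * \<beta>" using n by simp
  have "k * (\<beta> + \<gamma>) = 1" using mk mk' by (simp add: algebra_simps)
  then have "k = 1 / (\<beta> + \<gamma>)" using pos by (simp add: field_simps)
  then show ?thesis using m mk mk' by simp
qed

text \<open>Area over semiperimeter for \<open>P B D\<close>. Area and side \<open>B D\<close> are
  fixed by the ratio in which \<open>D\<close> divides \<open>B C\<close>, side \<open>P D\<close>
  by the ratio in which \<open>P\<close> divides \<open>A D\<close>; scaling by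
  \<open>\<beta> + \<gamma>\<close> clears the denominators.\<close>

lemma inradius_cevian_triangle:
  assumes nc: "\<not> collinear {A, B, C}"
    and P: "P = \<alpha> *\<^sub>R A + \<beta> *\<^sub>R B + \<gamma> *\<^sub>R C" "\<alpha> + \<beta> + \<gamma> = 1"
    and pos: "\<alpha> > 0" "\<beta> > 0" "\<gamma> > 0"
    and D: "D \<in> closed_segment B C" "D \<in> affine hull {A, P}"
  shows "inradius P B D = area2 A B C * \<alpha> * \<gamma> /
     ((\<beta> + \<gamma>) * norm (P - B) + \<gamma> * norm (C - B) + \<alpha> * norm (P - A))"
proof -
  define m where "m = \<gamma> / (\<beta> + \<gamma>)"
  have bg: "\<beta> + \<gamma> > 0" using pos by simp
  have m: "m > 0" "m * (\<beta> + \<gamma>) = \<gamma>" "1 - m = \<beta> / (\<beta> + \<gamma>)"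
    using pos bg by (simp_all add: m_def field_simps)
  have De: "D = (1 - m) *\<^sub>R B + m *\<^sub>R C"
    using cevian_foot[OF assms] m by (simp add: m_def)
  have al: "\<alpha> = 1 - \<beta> - \<gamma>" using P(2) by simp
  have DP: "(\<beta> + \<gamma>) *\<^sub>R (D - P) = \<alpha> *\<^sub>R (P - A)"
  proof -
    have "(\<beta> + \<gamma>) *\<^sub>R D = \<beta> *\<^sub>R B + \<gamma> *\<^sub>R C"
      using cevian_foot[OF assms] bg by (simp add: scaleR_add_right)
    then show ?thesis unfolding P(1) al by (simp add: algebra_simps)
  qed
  have nDP: "(\<beta> + \<gamma>) * norm (D - P) = \<alpha> * norm (P - A)"
    using arg_cong[OF DP, of norm] bg pos by simp
  have "D - B = m *\<^sub>R (C - B)" unfolding De by (simp add: algebra_simps)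
  then have nDB: "norm (D - B) = m * norm (C - B)" using m by simp
  have "area2 P B D = m * area2 P B C"
  proof -
    have "cross2 (B - P) (D - P) = m * cross2 (B - P) (C - P)"
      unfolding De by (simp add: cross2_def algebra_simps)
    then show ?thesis using m by (simp add: area2_def abs_mult)
  qed
  then have ar: "area2 P B D = m * \<alpha> * area2 A B C"
    using area2_barycentric[OF P(2), of A B C] pos by (simp add: P(1))
  then have "\<not> collinear {P, B, D}"
    using nc m pos by (simp add: collinear_iff_area2)
  then have "inradius P B D = m * \<alpha> * area2 A B C / (norm (D - B) + norm (D - P) + norm (P - B))"
    by (simp add: inradius_eq ar norm_minus_commute)
  also have "\<dots> = (\<beta> + \<gamma>) * (m * \<alpha> * area2 A B C) / ((\<beta> + \<gamma>) * (norm (D - B) + norm (D - P) + norm (P - B)))"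
    using bg by simp
  also have "(\<beta> + \<gamma>) * (norm (D - B) + norm (D - P) + norm (P - B)) =
     (\<beta> + \<gamma>) * norm (P - B) + m * (\<beta> + \<gamma>) * norm (C - B) + \<alpha> * norm (P - A)"
    using nDP by (simp only: distrib_left[of "\<beta> + \<gamma>"] nDB) simp
  also have "(\<beta> + \<gamma>) * (m * \<alpha> * area2 A B C) = area2 A B C * \<alpha> * (m * (\<beta> + \<gamma>))"
    by simp
  finally show ?thesis unfolding m(2) .
qed

subsection \<open>The lengths in terms of the tangent of a quarter angle\<close>

text \<open>
  Here \<open>u\<close>, \<open>v\<close>, \<open>w\<close> are the tangent lengths from \<open>A\<close>, \<open>B\<close>, \<open>C\<close> to the incircle, whose radius is
  \<open>h * v\<close> with \<open>h = sqrt 3\<close> because the angle at \<open>B\<close> is \<open>120\<close> degrees; \<open>x = PA\<close>, \<open>2 * v = PB\<close>,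
  \<open>z = PC\<close>. The parameter \<open>p\<close> is the tangent of a quarter of the angle at \<open>A\<close>.
\<close>

lemma quarter_angle_parametrization:
  fixes u v w x z h :: real
  assumes h: "h\<^sup>2 = 3" "h > 0" and pos: "u > 0" "v > 0" "w > 0" "x > 0" "z > 0"
    and angle: "3 * v * (u + v + w) = u * w"
    and x: "x\<^sup>2 = u\<^sup>2 + 3 * v\<^sup>2" and z: "z\<^sup>2 = w\<^sup>2 + 3 * v\<^sup>2"
  obtains p t where "p > 0" "t > 0" "1 - 2 * h * p - p\<^sup>2 > 0"
    "v + w = t * (8 * p * (1 - p\<^sup>2))" "u + w = t * (h * (1 + p\<^sup>2)\<^sup>2)"
    "u + v = t * ((1 - 2 * h * p - p\<^sup>2) * (h - p) * (1 + h * p))"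
    "x = t * (h * (1 + p\<^sup>2) * (1 - 2 * h * p - p\<^sup>2))"
    "2 * v = t * (4 * p * (1 - 2 * h * p - p\<^sup>2))" "z = t * (4 * h * p * (1 + p\<^sup>2))"
proof -
  \<comment> \<open>The incircle has radius \<open>h * v\<close>, so half the angle at A has sine
    \<open>h * v / x\<close> and cosine \<open>u / x\<close>; this is the formula tan (A / 4) = (1 -
    cos (A / 2)) / sin (A / 2).\<close>
  define p where "p = (x - u) / (h * v)"
  define g where "g = 1 - 2 * h * p - p\<^sup>2"
  \<comment> \<open>Common scale, chosen so that all lengths become polynomials in \<open>p\<close>
    and \<open>h\<close> times \<open>t\<close>.\<close>
  define t where "t = v / (2 * p * g)"
  have "x > u" using x pos by (intro power_less_imp_less_base[of u 2 x]) auto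
  then have p: "p > 0" using pos h by (simp add: p_def)
  have hvp: "h * v * p = x - u" using pos h by (simp add: p_def)
  \<comment> \<open>The double angle formula for tan (A / 2) = \<open>h * v / u\<close>, multiplied
    by a positive factor that is cancelled next.\<close>
  have "(h * v) * (2 * p * u) = (h * v) * (h * v * (1 - p\<^sup>2))"
    using hvp x h(1) by algebra
  then have u: "2 * p * u = h * v * (1 - p\<^sup>2)" using pos h by simp
  \<comment> \<open>Solved for \<open>w\<close>, the angle condition has a positive right-hand side,
    so \<open>u > 3 * v\<close>. This says that the angle at A is below 60 degrees and will make
    \<open>g\<close> positive.\<close>
  have w: "w * (u - 3 * v) = 3 * v * (u + v)" using angle by algebra
  then have u3: "u - 3 * v > 0"
    using pos by (metis add_pos_pos mult_pos_pos zero_less_mult_pos zero_less_numeral)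
  have hvg: "h * v * g = 2 * p * (u - 3 * v)" unfolding g_def using u h(1) by algebra
  have "h * v * g > 0" unfolding hvg using p u3 by simp
  then have g: "g > 0" using pos h zero_less_mult_pos[of "h * v" g] by simp
  have t: "t > 0" using p g pos by (simp add: t_def)
  have v: "v = 2 * p * g * t" using p g by (simp add: t_def)
  have "2 * p * u = 2 * p * (h * (1 - p\<^sup>2) * g * t)" using u v by algebra
  then have u': "u = h * (1 - p\<^sup>2) * g * t" using p by simp
  have x': "x = h * (1 + p\<^sup>2) * g * t" using hvp u' v by algebra
  have "(h * v) * (w * g) = (h * v) * (g * (2 * h * p * (h * (1 - p\<^sup>2) + 2 * p) * t))"
    using hvg w u' v h(1) by algebra
  then have w': "w = 2 * h * p * (h * (1 - p\<^sup>2) + 2 * p) * t" using pos h g by simp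
  have "z\<^sup>2 = (4 * h * p * (1 + p\<^sup>2) * t)\<^sup>2"
    using z w' v h(1) unfolding g_def by algebra
  moreover have "4 * h * p * (1 + p\<^sup>2) * t \<ge> 0" using p t h by simp
  \<comment> \<open>The root is exact: in the sum of squares the mixed terms in \<open>h * p\<close>
    cancel, and what is left contains (1 - p^2)^2 + 4 p^2 = (1 + p^2)^2.\<close>
  ultimately have z': "z = 4 * h * p * (1 + p\<^sup>2) * t"
    using pos by (meson less_imp_le power2_eq_imp_eq)
  show ?thesis
  proof (rule that[OF p t, folded g_def])
    show "g > 0" by fact
    show "v + w = t * (8 * p * (1 - p\<^sup>2))" using v w' h(1) unfolding g_def by algebra
    show "u + w = t * (h * (1 + p\<^sup>2)\<^sup>2)" using u' w' h(1) unfolding g_def by algebra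
    show "u + v = t * (g * (h - p) * (1 + h * p))" using u' v h(1) by algebra
    show "x = t * (h * (1 + p\<^sup>2) * g)" using x' by simp
    show "2 * v = t * (4 * p * g)" using v by simp
    show "z = t * (4 * h * p * (1 + p\<^sup>2))" using z' by simp
  qed
qed

section \<open>The relation between the ratios of small inradii to the inradius of the whole
  triangle\<close>

lemma frac_eqI: "a * d = c * b \<Longrightarrow> b > 0 \<Longrightarrow> d > 0 \<Longrightarrow> a / b = c / (d::real)"
  by (simp add: frac_eq_eq)

text \<open>\<open>q1\<close>, \<open>q2\<close>, \<open>q4\<close> stand for \<open>r1\<close>,
  \<open>r2\<close>, \<open>r4\<close> divided by the inradius of the whole triangle, and
  \<open>x\<close>, \<open>y\<close>, \<open>z\<close> for the distances from the incenter to A, B,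
  C. In the parameter \<open>p\<close> everything becomes rational, and a polynomial identity
  remains.\<close>

lemma cevian_ratio_identity:
  fixes a b c s x y z h :: real
  assumes h: "h\<^sup>2 = 3" "h > 0" and pos: "a > 0" "b > 0" "c > 0" "x > 0" "y > 0" "z > 0"
    and angle: "b\<^sup>2 = a\<^sup>2 + c\<^sup>2 + a * c"
    and x: "(a + b + c) * x\<^sup>2 = b * c * (b + c - a)"
    and y: "(a + b + c) * y\<^sup>2 = a * c * (a + c - b)"
    and z: "(a + b + c) * z\<^sup>2 = a * b * (a + b - c)"
  defines "q1 \<equiv> a * c / ((b + c) * y + c * a + a * x)"
    and "q2 \<equiv> a * b / ((b + c) * z + b * a + a * x)"
    and "q4 \<equiv> b * c / ((a + c) * x + c * b + b * y)"
  shows "h * (q4 * (q1 + q2) - q1 * q2) = (h - 1) * q4"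
proof -
  \<comment> \<open>\<open>algebra\<close> succeeds below with this form of \<open>h(1)\<close>, but not with \<open>h(1)\<close> itself.\<close>
  have h0: "h\<^sup>2 - 3 = 0" using h by simp
  define u where "u = (b + c - a) / 2"
  define v where "v = (a + c - b) / 2"
  define w where "w = (a + b - c) / 2"
  \<comment> \<open>The strict triangle inequalities are read off from the positive squared
    distances.\<close>
  have "b * c * (b + c - a) > 0" "a * c * (a + c - b) > 0" "a * b * (a + b - c) > 0"
    unfolding x[symmetric] y[symmetric] z[symmetric] using pos by simp_all
  moreover have "b * c > 0" "a * c > 0" "a * b > 0" using pos by simp_all
  ultimately have "b + c - a > 0" "a + c - b > 0" "a + b - c > 0"
    using zero_less_mult_pos by blast+
  then have uvw: "u > 0" "v > 0" "w > 0" by (simp_all add: u_def v_def w_def)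
  have abc: "a = v + w" "b = u + w" "c = u + v" by (simp_all add: u_def v_def w_def field_simps)
  have s: "u + v + w > 0" using uvw by simp
  \<comment> \<open>In tangent lengths the law of cosines says that the squared inradius u v w / (u
    + v + w) is 3 v^2; the formulas for \<open>x\<close> and \<open>z\<close> are then Pythagoras at
    the points of tangency, and \<open>y = 2 * v\<close> reflects the half angle of 60 degrees at
    B.\<close>
  have an: "3 * v * (u + v + w) = u * w" using angle unfolding abc by algebra
  have "(u + v + w) * x\<^sup>2 = (u + v + w) * (u\<^sup>2 + 3 * v\<^sup>2)" using x an unfolding abc by algebra
  then have x2: "x\<^sup>2 = u\<^sup>2 + 3 * v\<^sup>2" using s by simp
  have "(u + v + w) * z\<^sup>2 = (u + v + w) * (w\<^sup>2 + 3 * v\<^sup>2)" using z an unfolding abc by algebra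
  then have z2: "z\<^sup>2 = w\<^sup>2 + 3 * v\<^sup>2" using s by simp
  have "(u + v + w) * y\<^sup>2 = (u + v + w) * (2 * v)\<^sup>2" using y an unfolding abc by algebra
  then have "y\<^sup>2 = (2 * v)\<^sup>2" using s by simp
  then have y2: "y = 2 * v"
    by (rule power2_eq_imp_eq) (use pos(5) uvw(2) in linarith)+
  obtain p t where p: "p > 0" and t: "t > 0" and g0: "1 - 2 * h * p - p\<^sup>2 > 0"
    and e: "a = t * (8 * p * (1 - p\<^sup>2))" "b = t * (h * (1 + p\<^sup>2)\<^sup>2)"
    "c = t * ((1 - 2 * h * p - p\<^sup>2) * (h - p) * (1 + h * p))"
    "x = t * (h * (1 + p\<^sup>2) * (1 - 2 * h * p - p\<^sup>2))"
    "y = t * (4 * p * (1 - 2 * h * p - p\<^sup>2))" "z = t * (4 * h * p * (1 + p\<^sup>2))"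
    using quarter_angle_parametrization[OF h uvw pos(4,6) an x2 z2] unfolding abc[symmetric] y2[symmetric] .
  have hp: "h * p > 0" using h p by simp
  then have hp1: "1 - h * p > 0" using g0 zero_le_power2[of p] by (simp only: mult.assoc)
  have d4: "1 + 2 * h * p - p\<^sup>2 > 0" using g0 hp by (simp only: mult.assoc)
  \<comment> \<open>The ratios are homogeneous of degree 0 in the lengths, so \<open>t\<close>
    cancels in all three closed forms; cross-multiplied, they are polynomial identities modulo
    \<open>h\<^sup>2 = 3\<close>.\<close>
  have q1: "q1 = (1 + h * p) / (h * (h + p))"
  proof -
    have "a * c * (h * (h + p)) = (1 + h * p) * ((b + c) * y + c * a + a * x)"
      unfolding e using h0 by algebra
    moreover have "(b + c) * y + c * a + a * x > 0" "h * (h + p) > 0"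
      by (intro add_pos_pos mult_pos_pos; use pos h p in simp)+
    ultimately show ?thesis unfolding q1_def by (rule frac_eqI)
  qed
  have q2: "q2 = (1 + p\<^sup>2) / ((2 + h + p) * (1 - h * p))"
  proof -
    have "a * b * ((2 + h + p) * (1 - h * p)) = (1 + p\<^sup>2) * ((b + c) * z + b * a + a * x)"
      unfolding e using h0 by algebra
    moreover have "(b + c) * z + b * a + a * x > 0" "(2 + h + p) * (1 - h * p) > 0"
      by (intro add_pos_pos mult_pos_pos; use pos h p hp1 in simp)+
    ultimately show ?thesis unfolding q2_def by (rule frac_eqI)
  qed
  have q4: "q4 = (1 + p\<^sup>2) * (1 + h * p) / (2 * (1 + 2 * h * p - p\<^sup>2))"
  proof -
    have "b * c * (2 * (1 + 2 * h * p - p\<^sup>2)) = (1 + p\<^sup>2) * (1 + h * p) * ((a + c) * x + c * b + b * y)"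
      unfolding e using h0 by algebra
    moreover have "(a + c) * x + c * b + b * y > 0"
      by (intro add_pos_pos mult_pos_pos; use pos in simp)
    moreover have "2 * (1 + 2 * h * p - p\<^sup>2) > 0" using d4 by simp
    ultimately show ?thesis unfolding q4_def by (rule frac_eqI)
  qed
  \<comment> \<open>Denominators of the closed forms. Multiplying by their product pairs each ratio
    with its own denominator.\<close>
  define d1 d2 d3 where "d1 = h * (h + p)" and "d2 = (2 + h + p) * (1 - h * p)"
    and "d3 = 2 * (1 + 2 * h * p - p\<^sup>2)"
  have nz: "d1 \<noteq> 0" "d2 \<noteq> 0" "d3 \<noteq> 0" using h p hp1 d4 by (auto simp: d1_def d2_def d3_def)
  have m: "q1 * d1 = 1 + h * p" "q2 * d2 = 1 + p\<^sup>2" "q4 * d3 = (1 + p\<^sup>2) * (1 + h * p)"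
    using nz unfolding q1 q2 q4 d1_def d2_def d3_def by simp_all
  have "(d1 * d2 * d3) * (h * (q4 * (q1 + q2) - q1 * q2)) =
     h * ((q4 * d3) * ((q1 * d1) * d2 + (q2 * d2) * d1) - (q1 * d1) * (q2 * d2) * d3)"
    by (simp add: algebra_simps)
  also have "\<dots> = (h - 1) * d1 * d2 * ((1 + p\<^sup>2) * (1 + h * p))"
    unfolding m unfolding d1_def d2_def d3_def using h0 by algebra
  also have "\<dots> = (d1 * d2 * d3) * ((h - 1) * q4)" unfolding m(3)[symmetric] by simp
  finally show ?thesis using nz by simp
qed

subsection \<open>Triangles cut off by the cevians through the incenter\<close>

lemma is_incenterD:
  assumes nc: "\<not> collinear {A, B, C}" and P: "is_incenter A B C P"
  defines "a \<equiv> norm (C - B)" and "b \<equiv> norm (A - C)" and "c \<equiv> norm (B - A)"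
  shows "P = (a / (a + b + c)) *\<^sub>R A + (b / (a + b + c)) *\<^sub>R B + (c / (a + b + c)) *\<^sub>R C"
  using P is_incircle_iff[OF nc]
  by (auto simp: is_incenter_def a_def b_def c_def scaleR_add_right)

text \<open>The squared norm of \<open>(a + b + c) *\<^sub>R (P - A)\<close> is expanded in the two
  edges at \<open>A\<close>, and the law of cosines removes their inner product. One factor
  \<open>a + b + c\<close> then cancels.\<close>

lemma incenter_vertex_dist:
  assumes nc: "\<not> collinear {A, B, C}" and P: "is_incenter A B C P"
  defines "a \<equiv> norm (C - B)" and "b \<equiv> norm (A - C)" and "c \<equiv> norm (B - A)"
  shows "(a + b + c) * (norm (P - A))\<^sup>2 = b * c * (b + c - a)"
proof -
  define s where "s = a + b + c"
  note ne = not_collinear_distinct[OF nc]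
  have s: "s > 0" using ne by (simp add: s_def a_def b_def c_def add_pos_pos)
  have "s *\<^sub>R P = a *\<^sub>R A + b *\<^sub>R B + c *\<^sub>R C"
    using is_incenterD[OF nc P] s by (simp add: s_def a_def b_def c_def scaleR_add_right)
  then have v: "s *\<^sub>R (P - A) = b *\<^sub>R (B - A) + c *\<^sub>R (C - A)"
    by (simp add: s_def algebra_simps)
  have b: "b = norm (C - A)" by (simp add: b_def norm_minus_commute)
  have a2: "a\<^sup>2 = b\<^sup>2 + c\<^sup>2 - 2 * ((B - A) \<bullet> (C - A))"
    unfolding a_def b c_def power2_norm_eq_inner by (simp add: inner_diff inner_commute)
  have "s\<^sup>2 * (norm (P - A))\<^sup>2 = (s *\<^sub>R (P - A)) \<bullet> (s *\<^sub>R (P - A))"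
    by (simp add: dot_square_norm power2_eq_square)
  also have "\<dots> = b\<^sup>2 * ((B - A) \<bullet> (B - A)) + c\<^sup>2 * ((C - A) \<bullet> (C - A)) + 2 * b * c * ((B - A) \<bullet> (C - A))"
    unfolding v by (simp only: inner_add_left inner_add_right inner_scaleR_left inner_scaleR_right
        inner_commute[of "C - A" "B - A"]) algebra
  also have "\<dots> = b\<^sup>2 * c\<^sup>2 + c\<^sup>2 * b\<^sup>2 + 2 * b * c * ((B - A) \<bullet> (C - A))"
    unfolding c_def b power2_norm_eq_inner ..
  \<comment> \<open>The factor \<open>s\<close> comes from the difference of squares (b + c)^2 -
    a^2.\<close>
  also have "\<dots> = s * (b * c * (b + c - a))" using a2 unfolding s_def by algebra
  finally show ?thesis using s by (simp add: power2_eq_square s_def)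
qed

text \<open>The cevian formula with side lengths as weights, arranged so that the inradius of
  \<open>A B C\<close> splits off as the first factor.\<close>

lemma inradius_incenter_cevian_triangle:
  assumes nc: "\<not> collinear {A, B, C}" and P: "is_incenter A B C P"
    and D: "D \<in> closed_segment B C" "D \<in> affine hull {A, P}"
  defines "a \<equiv> norm (C - B)" and "b \<equiv> norm (A - C)" and "c \<equiv> norm (B - A)"
  shows "inradius P B D = area2 A B C / (a + b + c) *
     (a * c / ((b + c) * norm (P - B) + c * a + a * norm (P - A)))"
proof -
  define s where "s = a + b + c"
  note ne = not_collinear_distinct[OF nc]
  have pos: "a > 0" "b > 0" "c > 0" using ne by (simp_all add: a_def b_def c_def)
  then have s: "s > 0" by (simp add: s_def)
  have "a / s + b / s + c / s = 1" using s by (simp add: add_divide_distrib[symmetric]) (simp add: s_def)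
  then have "inradius P B D = area2 A B C * (a / s) * (c / s) /
     ((b / s + c / s) * norm (P - B) + (c / s) * norm (C - B) + (a / s) * norm (P - A))"
    using is_incenterD[OF nc P] s pos D
    by (intro inradius_cevian_triangle[OF nc]) (simp_all add: s_def a_def b_def c_def)
  also have "\<dots> = area2 A B C * (a / s) * (c / s) /
     (((b + c) * norm (P - B) + c * a + a * norm (P - A)) / s)"
    by (simp add: a_def add_divide_distrib distrib_right)
  also have "\<dots> = area2 A B C / s * (a * c / ((b + c) * norm (P - B) + c * a + a * norm (P - A)))"
    using s by simp
  finally show ?thesis unfolding s_def .
qed

section \<open>The 120 degree angle and the two halves of the figure\<close>

lemma law_of_cosines_120:
  assumes "A \<noteq> B" "C \<noteq> B" and angle: "angle A B C = 2 * pi / 3"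
  shows "(norm (A - C))\<^sup>2 = (norm (C - B))\<^sup>2 + (norm (B - A))\<^sup>2 + norm (C - B) * norm (B - A)"
proof -
  let ?d = "((A - B) \<bullet> (C - B)) / (norm (A - B) * norm (C - B))"
  have n: "norm (A - B) * norm (C - B) > 0" using assms by simp
  \<comment> \<open>Cauchy-Schwarz puts the argument of \<open>arccos\<close> in its domain, so the
    cosine can be recovered from the angle.\<close>
  have "\<bar>?d\<bar> \<le> 1" using Cauchy_Schwarz_ineq2[of "A - B" "C - B"] n by (simp add: divide_le_eq)
  then have "?d = cos (2 * pi / 3)" using angle by (metis angle_def cos_arccos_abs)
  then have "?d = - 1 / 2" by (simp only: cos_120)
  then have "(A - B) \<bullet> (C - B) = - (norm (A - B) * norm (C - B)) / 2"
    using assms(1,2) by (simp add: divide_eq_eq)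
  moreover have "(norm (A - C))\<^sup>2 = (norm (C - B))\<^sup>2 + (norm (A - B))\<^sup>2 - 2 * ((A - B) \<bullet> (C - B))"
    unfolding power2_norm_eq_inner by (simp add: inner_diff inner_commute)
  ultimately show ?thesis by (simp add: norm_minus_commute mult.commute)
qed

lemma inradii_identity_120:
  assumes nc: "\<not> collinear {A, B, C}"
    and angle: "angle A B C = 2 * pi / 3"
    and P: "is_incenter A B C P"
    and D: "D \<in> closed_segment B C" "D \<in> affine hull {A, P}"
    and E: "E \<in> closed_segment C A" "E \<in> affine hull {B, P}"
  defines "r1 \<equiv> inradius P B D" and "r2 \<equiv> inradius P D C" and "r4 \<equiv> inradius P E A"
  shows "sqrt 3 * (r4 * (r1 + r2) - r1 * r2) = (sqrt 3 - 1) * inradius A B C * r4"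
proof -
  define a b c where "a = norm (C - B)" and "b = norm (A - C)" and "c = norm (B - A)"
  define x y z where "x = norm (P - A)" and "y = norm (P - B)" and "z = norm (P - C)"
  define k where "k = inradius A B C"
  have k: "k = area2 A B C / (a + b + c)" using inradius_eq[OF nc] by (simp add: k_def a_def b_def c_def)
  note ne = not_collinear_distinct[OF nc]
  have pos: "a > 0" "b > 0" "c > 0" using ne by (simp_all add: a_def b_def c_def)
  have nc': "\<not> collinear {A, C, B}" "\<not> collinear {B, A, C}" "\<not> collinear {B, C, A}" "\<not> collinear {C, A, B}"
    using nc by (simp_all add: insert_commute)
  have P': "is_incenter A C B P" "is_incenter B A C P" "is_incenter B C A P" "is_incenter C A B P"
    using P unfolding is_incenter_def is_incircle_def by (simp_all only: insert_commute conj_ac)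
  have ar: "area2 A C B = area2 A B C" "area2 B A C = area2 A B C"
    by (metis area2_swap area2_rotate)+
  have len: "norm (B - C) = a" "norm (C - A) = b" "norm (A - B) = c"
    by (simp_all add: a_def b_def c_def norm_minus_commute)
  note len' = len a_def[symmetric] b_def[symmetric] c_def[symmetric]
    x_def[symmetric] y_def[symmetric] z_def[symmetric]
  define q1 q2 q4 where "q1 = a * c / ((b + c) * y + c * a + a * x)"
    and "q2 = a * b / ((b + c) * z + b * a + a * x)"
    and "q4 = b * c / ((a + c) * x + c * b + b * y)"
  have r1: "r1 = k * q1"
    using inradius_incenter_cevian_triangle[OF nc P D] unfolding r1_def q1_def k len' .
  \<comment> \<open>The same formula covers all three triangles: \<open>r2\<close> comes from
    exchanging \<open>B\<close> and \<open>C\<close>, and \<open>r4\<close> from exchanging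
    \<open>A\<close> and \<open>B\<close>, with \<open>E\<close> in the role of
    \<open>D\<close>.\<close>
  have r2: "r2 = k * q2"
    using inradius_incenter_cevian_triangle[OF nc'(1) P'(1), of D] D
    unfolding r2_def q2_def k len' inradius_swap[of P C D] ar by (simp add: closed_segment_commute add_ac)
  have r4: "r4 = k * q4"
    using inradius_incenter_cevian_triangle[OF nc'(2) P'(2), of E] E
    unfolding r4_def q4_def k len' inradius_swap[of P A E] ar by (simp add: closed_segment_commute add_ac)
  have x: "(a + b + c) * x\<^sup>2 = b * c * (b + c - a)"
    using incenter_vertex_dist[OF nc P] unfolding len' .
  have y: "(a + b + c) * y\<^sup>2 = a * c * (a + c - b)"
    using incenter_vertex_dist[OF nc'(3) P'(3)] unfolding len' by (simp add: algebra_simps)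
  have z: "(a + b + c) * z\<^sup>2 = a * b * (a + b - c)"
    using incenter_vertex_dist[OF nc'(4) P'(4)] unfolding len' by (simp add: algebra_simps)
  have an: "b\<^sup>2 = a\<^sup>2 + c\<^sup>2 + a * c"
    using law_of_cosines_120[OF _ _ angle] ne unfolding len' by metis
  have "b\<^sup>2 < (a + c)\<^sup>2" "a\<^sup>2 < b\<^sup>2" "c\<^sup>2 < b\<^sup>2"
    unfolding an power2_sum using pos by (simp_all add: add_pos_pos)
  \<comment> \<open>The side opposite the obtuse angle is the longest, yet shorter than the sum of
    the other two; hence the distances from \<open>P\<close> to the vertices are positive.\<close>
  then have "b < a + c" "a < b" "c < b"
    using pos by (meson power_less_imp_less_base add_pos_pos less_imp_le)+
  then have "(a + b + c) * x\<^sup>2 > 0" "(a + b + c) * y\<^sup>2 > 0" "(a + b + c) * z\<^sup>2 > 0"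
    unfolding x y z using pos by simp_all
  then have xyz: "x > 0" "y > 0" "z > 0"
    using pos by (simp_all add: x_def y_def z_def zero_less_mult_iff)
  have "sqrt 3 * (q4 * (q1 + q2) - q1 * q2) = (sqrt 3 - 1) * q4"
    using cevian_ratio_identity[of "sqrt 3", OF _ _ pos xyz an x y z]
    unfolding q1_def q2_def q4_def by simp
  then show ?thesis unfolding r1 r2 r4 k_def[symmetric] by algebra
qed

theorem theorem6p2:
  fixes A B C P D E F :: "real^2"
    and r1 r2 r3 r4 r5 r6 :: real
  assumes "\<not> collinear {A, B, C}"
    and "angle A B C = 2 * pi / 3"
    and "is_incenter A B C P"
    and "D \<in> closed_segment B C" and "D \<in> affine hull {A, P}"
    and "E \<in> closed_segment C A" and "E \<in> affine hull {B, P}"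
    and "F \<in> closed_segment A B" and "F \<in> affine hull {C, P}"
    and "r1 = inradius P B D" and "r2 = inradius P D C" and "r3 = inradius P C E"
    and "r4 = inradius P E A" and "r5 = inradius P A F" and "r6 = inradius P F B"
  shows "r1 * r2 * r3 + r3 * r4 * r5 + r3 * r4 * r6 =
         r1 * r3 * r4 + r2 * r3 * r4 + r4 * r5 * r6"
proof -
  define \<rho> where "\<rho> = inradius A B C"
  \<comment> \<open>The mirrored figure: exchanging \<open>A\<close> and \<open>C\<close> puts
    \<open>F\<close> in place of \<open>D\<close> and turns \<open>r1\<close>, \<open>r2\<close>,
    \<open>r4\<close> into \<open>r6\<close>, \<open>r5\<close>, \<open>r3\<close>.\<close>
  have rev1: "\<not> collinear {C, B, A}" using assms(1) by (simp only: insert_commute simp_thms)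
  have rev2: "angle C B A = 2 * pi / 3"
    using assms(2) unfolding angle_def by (simp only: inner_commute mult.commute)
  have rev3: "is_incenter C B A P"
    using assms(3) unfolding is_incenter_def is_incircle_def by (simp only: insert_commute conj_ac)
  note rev = rev1 rev2 rev3
  have "inradius C B A = \<rho>"
    unfolding \<rho>_def inradius_def is_incircle_def by (simp only: insert_commute conj_ac)
  then have right: "sqrt 3 * (r3 * (r6 + r5) - r6 * r5) = (sqrt 3 - 1) * \<rho> * r3"
    using inradii_identity_120[OF rev, of F E] assms(6-15)
    by (simp add: closed_segment_commute inradius_swap)
  have left: "sqrt 3 * (r4 * (r1 + r2) - r1 * r2) = (sqrt 3 - 1) * \<rho> * r4"
    using inradii_identity_120[OF assms(1-7)] by (simp add: assms(10-15) \<rho>_def)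
  \<comment> \<open>Multiplied by \<open>r3\<close> and \<open>r4\<close> respectively, the two
    half-figure relations have the same right-hand side.\<close>
  have "sqrt 3 * (r3 * (r4 * (r1 + r2) - r1 * r2)) = sqrt 3 * (r4 * (r3 * (r6 + r5) - r6 * r5))"
    using left right by algebra
  then have "r3 * (r4 * (r1 + r2) - r1 * r2) = r4 * (r3 * (r6 + r5) - r6 * r5)" by simp
  then show ?thesis by (simp add: algebra_simps)
qed

end
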